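(* Let $\mathfrak g$ be a finite-dimensional Lie algebra over $\mathbb K=\mathbb R$ or $\mathbb C$ with an ad-invariant metric $g$ such that the eigenvalues of the metric Nikolayevsky derivation of $(\mathfrak g,g)$ are positive. Then the metric $g$ is solitary.
   Context: A metric on a Lie algebra $\mathfrak g$ is a nondegenerate symmetric $\mathbb K$-bilinear form $g$; it is ad-invariant if $g([X,Y],Z)=-g(Y,[X,Z])$ for all $X,Y,Z\in\mathfrak g$. A linear map $\phi\colon\mathfrak g\to\mathfrak g$ is ad-invariant if $\phi([X,Y])=[X,\phi(Y)]$ for all $X,Y$. For a linear map $f$, $f^{*_g}$ denotes its adjoint with respect to $g$. An ad-invariant metric $g$ is solitary if every ad-invariant $g$-self-adjoint linear map $\phi\colon\mathfrak g\to\mathfrak g$ can be written as $\phi=D+D^{*_g}$ for some derivation $D$ of $\mathfrak g$. Let $\mathfrak{co}(\mathfrak g,g)=\{f\in\mathfrak{gl}(\mathfrak g): \exists\, l\in\mathbb K,\ g(fX,Y)+g(X,fY)=l\,g(X,Y)\ \forall X,Y\in\mathfrak g\}$. A metric Nikolayevsky derivation of $(\mathfrak g,g)$ is a semisimple (diagonalizable over $\mathbb C$) derivation $N\in\mathfrak{co}(\mathfrak g,g)\cap\mathrm{Der}(\mathfrak g)$ such that $\mathrm{tr}(N\psi)=\mathrm{tr}(\psi)$ for every $\psi\in\mathfrak{co}(\mathfrak g,g)\cap\mathrm{Der}(\mathfrak g)$. Such an $N$ always exists, has rational eigenvalues, and is unique up to conjugation by automorphisms of $\mathfrak g$ preserving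 $g$ up to a scalar factor. *)

theory Defs
  imports "Jordan_Normal_Form.Char_Poly"
begin

text \<open>
  The ground field is either the reals or the complex numbers.  The class carries the embedding
  into the complex numbers that is needed to speak about complexified matrices; up to field
  isomorphism its only members are the two instances below.
\<close>

class real_or_complex = field +
  fixes to_complex :: "'a \<Rightarrow> complex"
  assumes to_complex_one: "to_complex 1 = 1"
    and to_complex_add: "to_complex (x + y) = to_complex x + to_complex y"
    and to_complex_mult: "to_complex (x * y) = to_complex x * to_complex y"
    and range_to_complex: "range to_complex = \<real> \<or> range to_complex = UNIV"

instantiation real :: real_or_complex
begin

definition to_complex_real :: "real \<Rightarrow> complex"
  where "to_complex_real = complex_of_real"

instance
  by standard (auto simp: to_complex_real_def Reals_def)

end

instantiation complex :: real_or_complex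
begin

definition to_complex_complex :: "complex \<Rightarrow> complex"
  where "to_complex_complex = (\<lambda>z. z)"

instance
  by standard (auto simp: to_complex_complex_def)

end


text \<open>
  The Lie algebra is a whole type \<open>'v\<close>; \<open>Basis\<close> is an arbitrary finite basis.  It occurs in the
  trace and in the representing matrix below, but only basis-independent properties of the matrix
  (diagonalizability, eigenvalues) are used.
\<close>

locale lie_algebra = finite_dimensional_vector_space scale Basis
  for scale :: "'k::real_or_complex \<Rightarrow> 'v::ab_group_add \<Rightarrow> 'v" and Basis :: "'v set" +
  fixes bracket :: "'v \<Rightarrow> 'v \<Rightarrow> 'v"
  assumes bracket_linear_left: "Vector_Spaces.linear scale scale (\<lambda>X. bracket X Y)"
    and bracket_linear_right: "Vector_Spaces.linear scale scale (\<lambda>Y. bracket X Y)"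
    and bracket_self: "bracket X X = 0"
    and jacobi: "bracket X (bracket Y Z) + bracket Y (bracket Z X) + bracket Z (bracket X Y) = 0"
begin

abbreviation endomorphism :: "('v \<Rightarrow> 'v) \<Rightarrow> bool"
  where "endomorphism f \<equiv> Vector_Spaces.linear scale scale f"

definition derivation :: "('v \<Rightarrow> 'v) \<Rightarrow> bool"
  where "derivation D \<longleftrightarrow> endomorphism D \<and>
    (\<forall>X Y. D (bracket X Y) = bracket (D X) Y + bracket X (D Y))"

definition ad_invariant_map :: "('v \<Rightarrow> 'v) \<Rightarrow> bool"
  where "ad_invariant_map \<phi> \<longleftrightarrow> endomorphism \<phi> \<and>
    (\<forall>X Y. \<phi> (bracket X Y) = bracket X (\<phi> Y))"

definition is_metric :: "('v \<Rightarrow> 'v \<Rightarrow> 'k) \<Rightarrow> bool"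
  where "is_metric g \<longleftrightarrow>
    (\<forall>Y. Vector_Spaces.linear scale (*) (\<lambda>X. g X Y)) \<and>
    (\<forall>X. Vector_Spaces.linear scale (*) (\<lambda>Y. g X Y)) \<and>
    (\<forall>X Y. g X Y = g Y X) \<and>
    (\<forall>X. (\<forall>Y. g X Y = 0) \<longrightarrow> X = 0)"

definition ad_invariant_metric :: "('v \<Rightarrow> 'v \<Rightarrow> 'k) \<Rightarrow> bool"
  where "ad_invariant_metric g \<longleftrightarrow> is_metric g \<and>
    (\<forall>X Y Z. g (bracket X Y) Z = - g Y (bracket X Z))"

text \<open>Existence and uniqueness of the adjoint are proved below (\<open>adjoint_wrt_unique\<close>).\<close>

definition adjoint_wrt :: "('v \<Rightarrow> 'v \<Rightarrow> 'k) \<Rightarrow> ('v \<Rightarrow> 'v) \<Rightarrow> 'v \<Rightarrow> 'v"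
  where "adjoint_wrt g f = (THE h. \<forall>X Y. g (f X) Y = g X (h Y))"

definition solitary :: "('v \<Rightarrow> 'v \<Rightarrow> 'k) \<Rightarrow> bool"
  where "solitary g \<longleftrightarrow> ad_invariant_metric g \<and>
    (\<forall>\<phi>. ad_invariant_map \<phi> \<and> adjoint_wrt g \<phi> = \<phi> \<longrightarrow>
      (\<exists>D. derivation D \<and> (\<forall>X. \<phi> X = D X + adjoint_wrt g D X)))"

definition conformal :: "('v \<Rightarrow> 'v \<Rightarrow> 'k) \<Rightarrow> ('v \<Rightarrow> 'v) set"
  where "conformal g = {f. endomorphism f \<and>
    (\<exists>l. \<forall>X Y. g (f X) Y + g X (f Y) = l * g X Y)}"

definition trace :: "('v \<Rightarrow> 'v) \<Rightarrow> 'k"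
  where "trace f = (\<Sum>b\<in>Basis. representation Basis (f b) b)"

definition basis_list :: "'v list"
  where "basis_list = (SOME bs. set bs = Basis \<and> distinct bs)"

definition complex_matrix :: "('v \<Rightarrow> 'v) \<Rightarrow> complex mat"
  where "complex_matrix f = mat (card Basis) (card Basis)
    (\<lambda>(i, j). to_complex (representation Basis (f (basis_list ! j)) (basis_list ! i)))"

definition semisimple :: "('v \<Rightarrow> 'v) \<Rightarrow> bool"
  where "semisimple f \<longleftrightarrow> (\<exists>D. diagonal_mat D \<and> similar_mat (complex_matrix f) D)"

definition metric_nikolayevsky :: "('v \<Rightarrow> 'v \<Rightarrow> 'k) \<Rightarrow> ('v \<Rightarrow> 'v) \<Rightarrow> bool"
  where "metric_nikolayevsky g N \<longleftrightarrow>
    N \<in> conformal g \<and> derivation N \<and> semisimple N \<and>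
    (\<forall>\<psi>. \<psi> \<in> conformal g \<and> derivation \<psi> \<longrightarrow> trace (N \<circ> \<psi>) = trace \<psi>)"

text \<open>
  All complex eigenvalues are taken into account, also when the ground field is real; positive
  means real and positive.
\<close>

definition positive_eigenvalues :: "('v \<Rightarrow> 'v) \<Rightarrow> bool"
  where "positive_eigenvalues f \<longleftrightarrow>
    (\<forall>z. eigenvalue (complex_matrix f) z \<longrightarrow> z \<in> \<real> \<and> Re z > 0)"

lemma set_basis_list: "set basis_list = Basis" and distinct_basis_list: "distinct basis_list"
  using someI_ex[OF finite_distinct_list[OF finite_Basis]] unfolding basis_list_def by auto

lemma metric_eq:
  assumes g: "is_metric g" and eq: "\<And>b. b \<in> Basis \<Longrightarrow> g x b = g y b"
  shows "x = y"
proof -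
  have lin1: "Vector_Spaces.linear scale (*) (\<lambda>X. g X Y)"
    and lin2: "Vector_Spaces.linear scale (*) (g X)" for X Y
    using g by (auto simp: is_metric_def)
  interpret L1: Vector_Spaces.linear scale "(*)" "\<lambda>X. g X Y" for Y
    by (rule lin1)
  interpret L2: Vector_Spaces.linear scale "(*)" "g X" for X
    by (rule lin2)
  have "g x Y = g y Y" for Y
  proof (rule vector_space_pair.linear_eq_on[of scale "(*)" "g x" "g y" Y Basis])
    show "vector_space_pair scale ((*) :: 'k \<Rightarrow> 'k \<Rightarrow> 'k)"
      by unfold_locales
  qed (use lin2 eq span_Basis in auto)
  then have "g (x - y) Y = 0" for Y
    by (simp add: L1.diff)
  then show ?thesis
    using g unfolding is_metric_def by (metis eq_iff_diff_eq_0)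
qed

lemma adjoint_exists:
  assumes g: "is_metric g" and f: "endomorphism f"
  shows "\<exists>h. \<forall>X Y. g (f X) Y = g X (h Y)"
proof -
  have lin1: "Vector_Spaces.linear scale (*) (\<lambda>X. g X Y)"
    and sym: "g X Y = g Y X" for X Y
    using g by (auto simp: is_metric_def)
  interpret L1: Vector_Spaces.linear scale "(*)" "\<lambda>X. g X Y" for Y
    by (rule lin1)
  interpret f: Vector_Spaces.linear scale scale f
    by (rule f)
  define T where "T Z = (\<Sum>b\<in>Basis. scale (g Z b) b)" for Z
  have linT: "endomorphism T"
    unfolding T_def
    by unfold_locales
      (simp_all add: L1.add L1.scale scale_left_distrib sum.distrib scale_sum_right)
  have coeff: "c b = d b"
    if "(\<Sum>b\<in>Basis. scale (c b) b) = (\<Sum>b\<in>Basis. scale (d b) b)" "b \<in> Basis" for c d b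
  proof -
    have "(\<Sum>b\<in>Basis. scale (c b - d b) b) = 0"
      using that(1) by (simp add: scale_left_diff_distrib sum_subtractf)
    from independentD[OF independent_Basis finite_Basis order_refl this that(2)]
    show ?thesis by simp
  qed
  have "inj T"
    by (rule injI, rule metric_eq[OF g]) (auto simp: T_def dest: coeff)
  then have "surj T"
    using linear_inj_imp_surj[OF linT] by blast
  have "\<exists>Z. \<forall>X. g (f X) Y = g X Z" for Y
  proof -
    obtain Z where "T Z = (\<Sum>b\<in>Basis. scale (g (f b) Y) b)"
      using \<open>surj T\<close> by (metis surjD)
    then have Z: "g b Z = g (f b) Y" if "b \<in> Basis" for b
      using coeff[OF _ that, of "g Z" "\<lambda>b. g (f b) Y"] sym[of b Z] by (simp add: T_def)
    have "g (f X) Y = g X Z" for X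
    proof (rule vector_space_pair.linear_eq_on
        [of scale "(*)" "\<lambda>X. g (f X) Y" "\<lambda>X. g X Z" X Basis])
      show "vector_space_pair scale ((*) :: 'k \<Rightarrow> 'k \<Rightarrow> 'k)"
        by unfold_locales
      show "Vector_Spaces.linear scale (*) (\<lambda>X. g (f X) Y)"
        by unfold_locales (simp_all add: f.add f.scale L1.add L1.scale)
    qed (use lin1 Z span_Basis in auto)
    then show ?thesis by blast
  qed
  then show ?thesis by metis
qed

lemma adjoint_wrt_unique:
  assumes g: "is_metric g" and f: "endomorphism f"
  shows "(\<forall>X Y. g (f X) Y = g X (h Y)) \<longleftrightarrow> h = adjoint_wrt g f"
proof -
  obtain a where a: "\<forall>X Y. g (f X) Y = g X (a Y)"
    using adjoint_exists[OF g f] by blast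
  have uniq: "h = a" if "\<forall>X Y. g (f X) Y = g X (h Y)" for h
  proof
    fix Y
    have sym: "g X Z = g Z X" for X Z
      using g by (auto simp: is_metric_def)
    show "h Y = a Y"
      by (rule metric_eq[OF g]) (metis a that sym)
  qed
  have "adjoint_wrt g f = a"
    unfolding adjoint_wrt_def using a uniq by (rule the_equality)
  then show ?thesis
    using a uniq by blast
qed

end

end

theory Submission
  imports Defs
begin

text \<open>
  Let \<open>N\<close> be the metric Nikolayevsky derivation, so \<open>N + N\<^sup>* = l\<close>. If \<open>\<psi>\<close> is
  ad-invariant and self-adjoint, then \<open>\<psi> \<circ> N\<close> is a derivation and
  \<open>\<psi> N + (\<psi> N)\<^sup>* = l \<psi> - N \<psi> + \<psi> N =: T \<psi>\<close>. So it suffices that \<open>T\<close> maps the space of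
  ad-invariant self-adjoint maps onto itself. The eigenvalues of \<open>T\<close> on all endomorphisms are the
  numbers \<open>l - a + b\<close> with \<open>a\<close>, \<open>b\<close> eigenvalues of \<open>N\<close>; as \<open>l - a\<close> is again an eigenvalue of
  \<open>N\<close>, they are positive, and \<open>T\<close> is annihilated by a product of factors \<open>T - c\<close>, all \<open>c \<noteq> 0\<close>.
\<close>

section \<open>The embedding of the ground field into the complex numbers\<close>

lemma to_complex_0 [simp]: "to_complex 0 = 0"
  using to_complex_add[of 0 0] by simp

lemma to_complex_minus: "to_complex (- x) = - to_complex x"
  using to_complex_add[of x "- x"] by (simp add: minus_unique)

lemma to_complex_diff: "to_complex (x - y) = to_complex x - to_complex y"
  using to_complex_add[of x "- y"] by (simp add: to_complex_minus)

lemma to_complex_sum: "to_complex (sum f A) = (\<Sum>x\<in>A. to_complex (f x))"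
  by (induction A rule: infinite_finite_induct) (simp_all add: to_complex_add)

lemma to_complex_eq_0_iff [simp]: "to_complex x = 0 \<longleftrightarrow> x = 0"
proof
  assume "to_complex x = 0"
  then show "x = 0"
    using to_complex_mult[of x "inverse x"] by (cases "x = 0") (simp_all add: to_complex_one)
qed simp

lemma to_complex_eq_iff [simp]: "to_complex x = to_complex y \<longleftrightarrow> x = y"
  using to_complex_eq_0_iff[of "x - y"] by (simp add: to_complex_diff)

text \<open>Positive eigenvalues are real, hence come from the ground field; this lets them act as
  scalars on the Lie algebra.\<close>

lemma Reals_subset_range_to_complex: "\<real> \<subseteq> range to_complex"
  using range_to_complex by auto

text \<open>Similar matrices share their characteristic polynomial, and that of the triangular
  matrix \<open>D\<close> splits into linear factors read off its diagonal.\<close>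

lemma eigenvalue_similar_diagonal:
  fixes A D :: "complex mat"
  assumes "similar_mat A D" "diagonal_mat D" "i < dim_row D"
  shows "eigenvalue A (D $$ (i, i))"
proof -
  obtain n where A: "A \<in> carrier_mat n n" and D: "D \<in> carrier_mat n n"
    using similar_matD[OF assms(1)] by auto
  have "upper_triangular D"
    using assms(2) D by (auto simp: diagonal_mat_def)
  then have "char_poly D = (\<Prod>a\<leftarrow>diag_mat D. [:- a, 1:])"
    by (rule char_poly_upper_triangular[OF D])
  moreover have "D $$ (i, i) \<in> set (diag_mat D)"
    using assms(3) by (auto simp: diag_mat_def)
  ultimately have "poly (char_poly D) (D $$ (i, i)) = 0"
    by (force simp: poly_prod_list prod_list_zero_iff)
  then show ?thesis
    using eigenvalue_root_char_poly[OF A] char_poly_similar[OF assms(1)] by simp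
qed

context lie_algebra
begin

section \<open>Complex coordinates and eigenfunctionals of semisimple maps\<close>

definition coordinates :: "'v \<Rightarrow> complex vec"
  where "coordinates v = vec (card Basis) (\<lambda>i. to_complex (representation Basis v (basis_list ! i)))"

lemma coordinates_carrier [simp]: "coordinates v \<in> carrier_vec (card Basis)"
  by (simp add: coordinates_def)

lemma length_basis_list: "length basis_list = card Basis"
  using distinct_card[OF distinct_basis_list] by (simp add: set_basis_list)

lemma sum_basis_list: "(\<Sum>b\<in>Basis. h b) = (\<Sum>j<card Basis. h (basis_list ! j))"
proof -
  have "bij_betw ((!) basis_list) {..<card Basis} Basis"
    using bij_betw_nth[OF distinct_basis_list] by (simp add: length_basis_list set_basis_list)
  then show ?thesis
    by (simp add: sum.reindex_bij_betw)
qed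

lemma representation_sum_Basis: "(\<Sum>b\<in>Basis. scale (representation Basis v b) b) = v"
  by (rule sum_representation_eq) (auto simp: independent_Basis span_Basis finite_Basis)

lemma coordinates_add: "coordinates (v + w) = coordinates v + coordinates w"
  by (auto simp: coordinates_def representation_add independent_Basis span_Basis to_complex_add)

lemma coordinates_scale: "coordinates (scale c v) = to_complex c \<cdot>\<^sub>v coordinates v"
  by (auto simp: coordinates_def representation_scale independent_Basis span_Basis to_complex_mult)

lemma coordinates_eq_0D:
  assumes "coordinates v = 0\<^sub>v (card Basis)"
  shows "v = 0"
proof -
  have "representation Basis v (basis_list ! i) = 0" if "i < card Basis" for i
    using arg_cong[OF assms, of "\<lambda>x. x $ i"] that by (simp add: coordinates_def)
  then show ?thesis
    using representation_sum_Basis[of v] by (simp add: sum_basis_list)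
qed

lemma coordinates_endomorphism:
  assumes "endomorphism f"
  shows "coordinates (f v) = complex_matrix f *\<^sub>v coordinates v"
proof (rule eq_vecI)
  interpret f: Vector_Spaces.linear scale scale f
    by (rule assms)
  fix i assume "i < dim_vec (complex_matrix f *\<^sub>v coordinates v)"
  then have i: "i < card Basis"
    by (simp add: complex_matrix_def)
  have "f v = (\<Sum>b\<in>Basis. scale (representation Basis v b) (f b))"
    by (subst representation_sum_Basis[of v, symmetric]) (simp add: f.sum f.scale)
  then have "representation Basis (f v) c =
      (\<Sum>b\<in>Basis. representation Basis v b * representation Basis (f b) c)" for c
    by (simp add: representation_sum representation_scale independent_Basis span_Basis)
  then have "coordinates (f v) $ i = (\<Sum>j<card Basis.
      to_complex (representation Basis v (basis_list ! j)) *
      to_complex (representation Basis (f (basis_list ! j)) (basis_list ! i)))"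
    using i by (simp add: coordinates_def sum_basis_list to_complex_sum to_complex_mult)
  also have "\<dots> = (complex_matrix f *\<^sub>v coordinates v) $ i"
    using i by (simp add: complex_matrix_def coordinates_def scalar_prod_def mult.commute
        lessThan_atLeast0)
  finally show "coordinates (f v) $ i = (complex_matrix f *\<^sub>v coordinates v) $ i" .
qed (simp add: complex_matrix_def coordinates_def)

text \<open>
  Diagonalizability as a separating family of (complex-valued) eigenfunctionals; unlike
  eigenvectors, these need not be descended from the complex numbers to the ground field.
\<close>

lemma semisimple_eigenfunctionals:
  assumes f: "endomorphism f" and ss: "semisimple f"
  obtains \<theta> :: "nat \<Rightarrow> 'v \<Rightarrow> complex" and d :: "nat \<Rightarrow> complex" where
    "\<And>i v w. i < card Basis \<Longrightarrow> \<theta> i (v + w) = \<theta> i v + \<theta> i w"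
    "\<And>i c v. i < card Basis \<Longrightarrow> \<theta> i (scale c v) = to_complex c * \<theta> i v"
    "\<And>i v. i < card Basis \<Longrightarrow> \<theta> i (f v) = d i * \<theta> i v"
    "\<And>v. (\<And>i. i < card Basis \<Longrightarrow> \<theta> i v = 0) \<Longrightarrow> v = 0"
    "\<And>i. i < card Basis \<Longrightarrow> eigenvalue (complex_matrix f) (d i)"
proof -
  define n where "n = card Basis"
  define A where "A = complex_matrix f"
  have A: "A \<in> carrier_mat n n"
    by (simp add: A_def complex_matrix_def n_def)
  obtain D where D: "diagonal_mat D" "similar_mat A D"
    using ss by (auto simp: semisimple_def A_def)
  then obtain P Q where "similar_mat_wit A D P Q"
    by (auto simp: similar_mat_def)
  from similar_mat_witD2[OF A this] have PQ: "P * Q = 1\<^sub>m n" "Q * P = 1\<^sub>m n" "A = P * D * Q"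
    and carr: "D \<in> carrier_mat n n" "P \<in> carrier_mat n n" "Q \<in> carrier_mat n n"
    by auto
  have x: "coordinates v \<in> carrier_vec n" for v
    by (simp add: n_def)
  have "Q * A = (Q * P) * D * Q"
    using carr by (simp add: PQ(3) assoc_mult_mat[of _ n n _ n _ n])
  then have QA: "Q * A = D * Q"
    using carr by (simp add: PQ(2))
  \<comment> \<open>By \<open>QA\<close> the rows of \<open>Q\<close> are left eigenvectors of
    \<open>A\<close>, hence eigenfunctionals of \<open>f\<close>. They separate vectors because
    \<open>P\<close> inverts \<open>Q\<close>.\<close>
  define \<theta> where "\<theta> i v = (Q *\<^sub>v coordinates v) $ i" for i v
  show ?thesis
  proof
    fix i v assume i: "i < card Basis"
    show "\<theta> i (v + w) = \<theta> i v + \<theta> i w" for w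
      using i carr x unfolding \<theta>_def coordinates_add n_def
      by (subst mult_add_distrib_mat_vec) auto
    show "\<theta> i (scale c v) = to_complex c * \<theta> i v" for c
      using i carr x unfolding \<theta>_def coordinates_scale n_def
      by (subst mult_mat_vec) auto
    have "Q *\<^sub>v coordinates (f v) = (Q * A) *\<^sub>v coordinates v"
      using carr A x by (simp add: coordinates_endomorphism[OF f] A_def)
    also have "\<dots> = D *\<^sub>v (Q *\<^sub>v coordinates v)"
      using carr x by (simp add: QA)
    finally have "\<theta> i (f v) = (\<Sum>j<n. D $$ (i, j) * \<theta> j v)"
      using i carr by (simp add: \<theta>_def n_def scalar_prod_def lessThan_atLeast0)
    also have "\<dots> = (\<Sum>j<n. if j = i then D $$ (i, i) * \<theta> i v else 0)"
      using D(1) i carr by (intro sum.cong) (auto simp: diagonal_mat_def n_def)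
    also have "\<dots> = D $$ (i, i) * \<theta> i v"
      using i by (simp add: n_def)
    finally show "\<theta> i (f v) = D $$ (i, i) * \<theta> i v" .
    show "eigenvalue (complex_matrix f) (D $$ (i, i))"
      using eigenvalue_similar_diagonal[OF D(2,1), of i] i carr by (simp add: A_def n_def)
  next
    fix v assume "\<And>i. i < card Basis \<Longrightarrow> \<theta> i v = 0"
    then have "Q *\<^sub>v coordinates v = 0\<^sub>v n"
      using carr by (auto simp: \<theta>_def n_def)
    then have "(P * Q) *\<^sub>v coordinates v = 0\<^sub>v n"
      using carr x by (auto simp: assoc_mult_mat_vec[of _ n n _ n])
    then show "v = 0"
      using x by (intro coordinates_eq_0D) (simp add: PQ(1) n_def)
  qed
qed

section \<open>Endomorphisms and the symmetry of the spectrum\<close>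

lemma endomorphismI:
  assumes "\<And>v w. f (v + w) = f v + f w" "\<And>c v. f (scale c v) = scale c (f v)"
  shows "endomorphism f"
  by unfold_locales (fact assms)+

lemma endomorphismD:
  assumes "endomorphism f"
  shows "f (v + w) = f v + f w" "f (v - w) = f v - f w" "f (scale c v) = scale c (f v)" "f 0 = 0"
proof -
  interpret f: Vector_Spaces.linear scale scale f
    by (rule assms)
  show "f (v + w) = f v + f w" "f (v - w) = f v - f w" "f (scale c v) = scale c (f v)" "f 0 = 0"
    by (rule f.add f.diff f.scale f.zero)+
qed

lemma endomorphism_inj_iff_surj: "endomorphism f \<Longrightarrow> inj f \<longleftrightarrow> surj f"
  using linear_inj_imp_surj linear_surj_imp_inj by blast

lemma endomorphism_shift: "endomorphism f \<Longrightarrow> endomorphism (\<lambda>v. f v - scale c v)"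
  by (rule endomorphismI)
    (simp_all add: endomorphismD scale_right_diff_distrib scale_right_distrib mult.commute)

lemma endomorphism_inj_iff:
  assumes "endomorphism f"
  shows "inj f \<longleftrightarrow> (\<forall>v. f v = 0 \<longrightarrow> v = 0)"
proof -
  have "f v = f w \<longleftrightarrow> f (v - w) = 0" for v w
    by (simp add: endomorphismD[OF assms])
  then show ?thesis
    by (metis eq_iff_diff_eq_0 endomorphismD(4)[OF assms] injD injI)
qed

text \<open>By \<open>l\<close>, the adjoint of \<open>f - (l - a)\<close> is
  \<open>-(f - a)\<close>, which kills \<open>x\<close>. So \<open>x\<close> is orthogonal to the
  image of \<open>f - (l - a)\<close>; by nondegeneracy this map is not surjective, and in finite
  dimension not injective either.\<close>

lemma conformal_eigenvalue_reflection:
  assumes g: "is_metric g" and f: "endomorphism f"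
    and l: "\<And>X Y. g (f X) Y + g X (f Y) = l * g X Y"
    and x: "x \<noteq> 0" "f x = scale a x"
  shows "\<exists>Y. Y \<noteq> 0 \<and> f Y = scale (l - a) Y"
proof (rule ccontr)
  assume "\<not> ?thesis"
  then have "inj (\<lambda>Y. f Y - scale (l - a) Y)"
    using endomorphism_inj_iff[OF endomorphism_shift[OF f]] by auto
  then have surj: "surj (\<lambda>Y. f Y - scale (l - a) Y)"
    using endomorphism_inj_iff_surj[OF endomorphism_shift[OF f]] by blast
  interpret L1: Vector_Spaces.linear scale "(*)" "\<lambda>x. g x y" for y
    using g by (simp add: is_metric_def)
  interpret L2: Vector_Spaces.linear scale "(*)" "g u" for u
    using g by (simp add: is_metric_def)
  have "g x (f Y - scale (l - a) Y) = g x (f Y) - (l - a) * g x Y" for Y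
    by (simp add: L2.diff L2.scale)
  also have "g x (f Y) - (l - a) * g x Y = g (f x) Y + g x (f Y) - l * g x Y" for Y
    by (simp add: x(2) L1.scale left_diff_distrib)
  finally have "g x (f Y - scale (l - a) Y) = 0" for Y
    by (simp add: l)
  then have "g x Z = 0" for Z
    using surjD[OF surj, of Z] by auto
  then show False
    using g x(1) by (auto simp: is_metric_def)
qed

section \<open>Self-adjoint ad-invariant maps and the operator \<open>T\<close>\<close>

definition self_adjoint_centroid :: "('v \<Rightarrow> 'v \<Rightarrow> 'k) \<Rightarrow> ('v \<Rightarrow> 'v) set"
  where "self_adjoint_centroid g =
    {\<phi>. ad_invariant_map \<phi> \<and> (\<forall>X Y. g (\<phi> X) Y = g X (\<phi> Y))}"

text \<open>This is the operator \<open>T\<close> of the introduction: left multiplication by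
  \<open>l - N\<close>, which is the adjoint of a conformal \<open>N\<close>, plus right
  multiplication by \<open>N\<close>.\<close>

definition sylvester :: "'k \<Rightarrow> ('v \<Rightarrow> 'v) \<Rightarrow> ('v \<Rightarrow> 'v) \<Rightarrow> 'v \<Rightarrow> 'v"
  where "sylvester l N \<psi> X = scale l (\<psi> X) - N (\<psi> X) + \<psi> (N X)"

lemma endomorphism_sylvester:
  assumes "endomorphism N" "endomorphism \<psi>"
  shows "endomorphism (sylvester l N \<psi>)"
  by (rule endomorphismI)
    (simp_all add: sylvester_def endomorphismD[OF assms(1)] endomorphismD[OF assms(2)]
      scale_right_distrib scale_right_diff_distrib mult.commute)

lemma bracket_right:
  "bracket X (Y + Z) = bracket X Y + bracket X Z"
  "bracket X (Y - Z) = bracket X Y - bracket X Z"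
  "bracket X (scale c Y) = scale c (bracket X Y)"
proof -
  interpret R: Vector_Spaces.linear scale scale "bracket X"
    by (rule bracket_linear_right)
  show "bracket X (Y + Z) = bracket X Y + bracket X Z"
    "bracket X (Y - Z) = bracket X Y - bracket X Z"
    "bracket X (scale c Y) = scale c (bracket X Y)"
    by (simp_all add: R.add R.diff R.scale)
qed

lemma bracket_antisym: "bracket X Y = - bracket Y X"
proof -
  interpret L: Vector_Spaces.linear scale scale "\<lambda>x. bracket x y" for y
    by (rule bracket_linear_left)
  have "bracket (X + Y) (X + Y) = bracket X Y + bracket Y X"
    by (simp only: L.add bracket_right) (simp add: bracket_self add.commute)
  then show ?thesis
    using bracket_self[of "X + Y"] by (simp add: eq_neg_iff_add_eq_0)
qed

lemma self_adjoint_centroid_lincomb: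
  assumes g: "is_metric g"
    and \<phi>: "\<phi> \<in> self_adjoint_centroid g" and \<psi>: "\<psi> \<in> self_adjoint_centroid g"
  shows "(\<lambda>X. scale a (\<phi> X) + scale b (\<psi> X)) \<in> self_adjoint_centroid g"
proof -
  interpret L1: Vector_Spaces.linear scale "(*)" "\<lambda>x. g x y" for y
    using g by (simp add: is_metric_def)
  interpret L2: Vector_Spaces.linear scale "(*)" "g u" for u
    using g by (simp add: is_metric_def)
  have "endomorphism \<phi>" "endomorphism \<psi>"
    using \<phi> \<psi> by (auto simp: self_adjoint_centroid_def ad_invariant_map_def)
  then have "endomorphism (\<lambda>X. scale a (\<phi> X) + scale b (\<psi> X))"
    by (intro endomorphismI)
      (simp_all add: endomorphismD scale_right_distrib mult.commute add_ac)
  then show ?thesis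
    using \<phi> \<psi>
    by (auto simp: self_adjoint_centroid_def ad_invariant_map_def bracket_right
        L1.add L2.add L1.scale L2.scale)
qed

text \<open>As \<open>\<psi>\<close> is self-adjoint, \<open>T \<psi>\<close> is the sum of
  \<open>\<psi> N\<close> and its adjoint. For ad-invariance, the two terms with
  \<open>bracket (N X) (\<psi> Y)\<close> produced by the Leibniz rule cancel.\<close>

lemma self_adjoint_centroid_sylvester:
  assumes g: "is_metric g" and N: "derivation N"
    and l: "\<And>X Y. g (N X) Y + g X (N Y) = l * g X Y"
    and \<psi>: "\<psi> \<in> self_adjoint_centroid g"
  shows "sylvester l N \<psi> \<in> self_adjoint_centroid g"
proof -
  interpret L1: Vector_Spaces.linear scale "(*)" "\<lambda>x. g x y" for y
    using g by (simp add: is_metric_def)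
  interpret L2: Vector_Spaces.linear scale "(*)" "g u" for u
    using g by (simp add: is_metric_def)
  have endN: "endomorphism N" and Nb: "N (bracket X Y) = bracket (N X) Y + bracket X (N Y)" for X Y
    using N by (auto simp: derivation_def)
  have end\<psi>: "endomorphism \<psi>" and inv: "\<psi> (bracket X Y) = bracket X (\<psi> Y)"
    and sa: "g (\<psi> X) Y = g X (\<psi> Y)" for X Y
    using \<psi> by (auto simp: self_adjoint_centroid_def ad_invariant_map_def)
  interpret N: Vector_Spaces.linear scale scale N by (rule endN)
  interpret \<psi>: Vector_Spaces.linear scale scale \<psi> by (rule end\<psi>)
  have "endomorphism (sylvester l N \<psi>)"
    by (rule endomorphism_sylvester[OF endN end\<psi>])
  moreover have "sylvester l N \<psi> (bracket X Y) = bracket X (sylvester l N \<psi> Y)" for X Y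
    by (simp add: sylvester_def inv Nb \<psi>.add bracket_right)
  moreover have "g (sylvester l N \<psi> X) Y = g X (sylvester l N \<psi> Y)" for X Y
  proof -
    \<comment> \<open>The conformal identity moves \<open>l - N\<close> from one argument of
      \<open>g\<close> to \<open>N\<close> on the other.\<close>
    have "g (sylvester l N \<psi> X) Y = g (\<psi> X) (N Y) + g (\<psi> (N X)) Y"
      using l[of "\<psi> X" Y] by (simp add: sylvester_def L1.add L1.diff L1.scale algebra_simps)
    also have "\<dots> = g X (\<psi> (N Y)) + g (N X) (\<psi> Y)"
      by (simp add: sa)
    also have "\<dots> = g X (sylvester l N \<psi> Y)"
      using l[of X "\<psi> Y"] by (simp add: sylvester_def L2.add L2.diff L2.scale algebra_simps)
    finally show ?thesis .
  qed
  ultimately show ?thesis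
    by (simp add: self_adjoint_centroid_def ad_invariant_map_def)
qed

text \<open>An ad-invariant map can be pulled out of either argument of the bracket, so following a
  derivation by it gives a derivation. The adjoint of \<open>\<psi> N\<close> is
  \<open>(l - N) \<psi>\<close>.\<close>

lemma sylvester_eq_derivation_plus_adjoint:
  assumes g: "is_metric g" and N: "derivation N"
    and l: "\<And>X Y. g (N X) Y + g X (N Y) = l * g X Y"
    and \<psi>: "\<psi> \<in> self_adjoint_centroid g"
  shows "derivation (\<psi> \<circ> N)"
    and "sylvester l N \<psi> v = (\<psi> \<circ> N) v + adjoint_wrt g (\<psi> \<circ> N) v"
proof -
  interpret L2: Vector_Spaces.linear scale "(*)" "g u" for u
    using g by (simp add: is_metric_def)
  have endN: "endomorphism N" and Nb: "N (bracket X Y) = bracket (N X) Y + bracket X (N Y)" for X Y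
    using N by (auto simp: derivation_def)
  have end\<psi>: "endomorphism \<psi>" and inv: "\<psi> (bracket X Y) = bracket X (\<psi> Y)"
    and sa: "g (\<psi> X) Y = g X (\<psi> Y)" for X Y
    using \<psi> by (auto simp: self_adjoint_centroid_def ad_invariant_map_def)
  interpret N: Vector_Spaces.linear scale scale N by (rule endN)
  interpret \<psi>: Vector_Spaces.linear scale scale \<psi> by (rule end\<psi>)
  have inv': "\<psi> (bracket X Y) = bracket (\<psi> X) Y" for X Y
    using inv[of Y X] bracket_antisym[of X Y] bracket_antisym[of "\<psi> X" Y] by (simp add: \<psi>.neg)
  have endD: "endomorphism (\<psi> \<circ> N)"
    by (rule endomorphismI) (simp_all add: N.add \<psi>.add N.scale \<psi>.scale)
  moreover have "\<psi> (N (bracket X Y)) = bracket (\<psi> (N X)) Y + bracket X (\<psi> (N Y))" for X Y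
    by (simp add: Nb \<psi>.add inv[of X] inv'[of "N X"])
  ultimately show "derivation (\<psi> \<circ> N)"
    by (simp add: derivation_def)
  have "g ((\<psi> \<circ> N) X) Y = g X (scale l (\<psi> Y) - N (\<psi> Y))" for X Y
    using l[of X "\<psi> Y"] by (simp add: sa L2.diff L2.scale algebra_simps)
  then have "(\<lambda>Y. scale l (\<psi> Y) - N (\<psi> Y)) = adjoint_wrt g (\<psi> \<circ> N)"
    by (intro iffD1[OF adjoint_wrt_unique[OF g endD]]) simp
  from fun_cong[OF this, of v]
  show "sylvester l N \<psi> v = (\<psi> \<circ> N) v + adjoint_wrt g (\<psi> \<circ> N) v"
    by (simp add: sylvester_def)
qed

section \<open>Surjectivity of \<open>T\<close> from an annihilating product of shifts\<close>

definition sylvester_prod :: "'k \<Rightarrow> ('v \<Rightarrow> 'v) \<Rightarrow> 'k list \<Rightarrow> ('v \<Rightarrow> 'v) \<Rightarrow> 'v \<Rightarrow> 'v"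
  where "sylvester_prod l N = fold (\<lambda>c \<psi> X. sylvester l N \<psi> X - scale c (\<psi> X))"

text \<open>A product of factors \<open>T - c\<close> with all \<open>c\<close> nonzero is a
  polynomial in \<open>T\<close> with nonzero constant term, so whatever it kills lies in the image
  of \<open>T\<close>. Removing one factor at a time keeps the preimage in the same space.\<close>

lemma sylvester_preimage:
  assumes g: "is_metric g" and N: "derivation N"
    and l: "\<And>X Y. g (N X) Y + g X (N Y) = l * g X Y"
  shows "\<phi> \<in> self_adjoint_centroid g \<Longrightarrow> 0 \<notin> set cs \<Longrightarrow> \<forall>X. sylvester_prod l N cs \<phi> X = 0 \<Longrightarrow>
    \<exists>\<psi>\<in>self_adjoint_centroid g. \<forall>X. \<phi> X = sylvester l N \<psi> X"
proof (induction cs arbitrary: \<phi>)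
  case Nil
  interpret N: Vector_Spaces.linear scale scale N
    using N by (simp add: derivation_def)
  from Nil have "\<phi> X = 0" for X
    by (simp add: sylvester_prod_def)
  then show ?case
    by (intro bexI[OF _ Nil(1)]) (simp_all add: sylvester_def)
next
  case (Cons c cs)
  interpret N: Vector_Spaces.linear scale scale N
    using N by (simp add: derivation_def)
  let ?\<phi>' = "\<lambda>X. sylvester l N \<phi> X - scale c (\<phi> X)"
  have "?\<phi>' \<in> self_adjoint_centroid g"
    using self_adjoint_centroid_lincomb[OF g self_adjoint_centroid_sylvester[OF g N l Cons.prems(1)]
        Cons.prems(1), of 1 "- c"] by simp
  then obtain \<psi> where \<psi>: "\<psi> \<in> self_adjoint_centroid g"
    and eq: "\<And>X. ?\<phi>' X = sylvester l N \<psi> X"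
    using Cons.IH[of ?\<phi>'] Cons.prems(2,3) by (auto simp: sylvester_prod_def)
  have c: "c \<noteq> 0"
    using Cons.prems(2) by auto
  \<comment> \<open>Solving \<open>T \<phi> - c \<phi> = T \<psi>\<close> gives
    \<open>\<phi> = T ((\<phi> - \<psi>) / c)\<close>.\<close>
  let ?\<psi>' = "\<lambda>X. scale (inverse c) (\<phi> X) + scale (- inverse c) (\<psi> X)"
  have "sylvester l N ?\<psi>' X = scale (inverse c) (sylvester l N \<phi> X - sylvester l N \<psi> X)" for X
    by (simp add: sylvester_def N.add N.diff N.scale scale_right_distrib scale_right_diff_distrib
        mult.commute)
  moreover have "sylvester l N \<phi> X - sylvester l N \<psi> X = scale c (\<phi> X)" for X
    using eq[of X] by (simp add: algebra_simps)
  ultimately have "\<phi> X = sylvester l N ?\<psi>' X" for X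
    using c by simp
  then show ?case
    using self_adjoint_centroid_lincomb[OF g Cons.prems(1) \<psi>, of "inverse c" "- inverse c"] by blast
qed

text \<open>
  Composing with an eigenfunctional \<open>\<theta>\<close> of \<open>N\<close> turns the left multiplication by \<open>N\<close> into a
  scalar, so that only the right multiplication remains.
\<close>

lemma eigenfunctional_sylvester_prod:
  fixes \<theta> :: "'v \<Rightarrow> complex"
  assumes \<theta>_add: "\<And>v w. \<theta> (v + w) = \<theta> v + \<theta> w"
    and \<theta>_scale: "\<And>c v. \<theta> (scale c v) = to_complex c * \<theta> v"
    and \<theta>_N: "\<And>v. \<theta> (N v) = to_complex a * \<theta> v"
  shows "endomorphism \<psi> \<Longrightarrow> endomorphism N \<Longrightarrow> \<theta> (sylvester_prod l N cs \<psi> v) =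
    \<theta> (\<psi> (foldr (\<lambda>c v. N v - scale (c - (l - a)) v) cs v))"
proof (induction cs arbitrary: \<psi>)
  case Nil
  then show ?case
    by (simp add: sylvester_prod_def)
next
  case (Cons c cs)
  interpret N: Vector_Spaces.linear scale scale N by (rule Cons.prems)
  interpret \<psi>: Vector_Spaces.linear scale scale \<psi> by (rule Cons.prems)
  have \<theta>_diff: "\<theta> (v - w) = \<theta> v - \<theta> w" for v w
    using \<theta>_add[of "v - w" w] by simp
  have "endomorphism (\<lambda>X. sylvester l N \<psi> X - scale c (\<psi> X))"
    by (rule endomorphismI) (simp_all add: endomorphismD[OF endomorphism_sylvester[OF Cons.prems(2,1)]]
        \<psi>.add \<psi>.scale scale_right_distrib scale_right_diff_distrib mult.commute)
  \<comment> \<open>Under \<open>\<theta>\<close>, the factor \<open>T - c\<close> on maps becomes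
    the shift \<open>N - (c - (l - a))\<close> on vectors. The head of the list acts first on maps
    (\<open>fold\<close>) and last on vectors (\<open>foldr\<close>).\<close>
  from Cons.IH[OF this Cons.prems(2)] show ?case
    by (simp add: sylvester_prod_def sylvester_def \<theta>_add \<theta>_diff \<theta>_scale \<theta>_N \<psi>.diff \<psi>.scale
        to_complex_diff ring_distribs)
qed

text \<open>A second eigenfunctional turns the remaining shifts into scalars. For
  \<open>k = l - a\<close> the factor of \<open>c = l - a + b\<close> vanishes.\<close>

lemma eigenfunctional_shift_prod:
  fixes \<theta> :: "'v \<Rightarrow> complex"
  assumes \<theta>_add: "\<And>v w. \<theta> (v + w) = \<theta> v + \<theta> w"
    and \<theta>_scale: "\<And>c v. \<theta> (scale c v) = to_complex c * \<theta> v"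
    and \<theta>_N: "\<And>v. \<theta> (N v) = to_complex b * \<theta> v"
  shows "\<theta> (foldr (\<lambda>c v. N v - scale (c - k) v) cs v) =
    (\<Prod>c\<leftarrow>cs. to_complex (k + b - c)) * \<theta> v"
proof (induction cs)
  case (Cons c cs)
  have \<theta>_diff: "\<theta> (v - w) = \<theta> v - \<theta> w" for v w
    using \<theta>_add[of "v - w" w] by simp
  show ?case
    by (simp add: \<theta>_diff \<theta>_scale \<theta>_N Cons.IH to_complex_diff to_complex_add ring_distribs mult.assoc)
qed simp

text \<open>The list \<open>cs\<close> collects all \<open>l - a i + a j\<close>. Testing with one
  eigenfunctional for the left and one for the right multiplication leaves a scalar product with a
  zero factor.\<close>

lemma semisimple_sylvester_prod_eq_0:
  assumes N: "endomorphism N" "semisimple N"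
    and pos: "positive_eigenvalues N"
    and g: "is_metric g" and l: "\<And>X Y. g (N X) Y + g X (N Y) = l * g X Y"
  obtains cs where "0 \<notin> set cs" "\<And>\<psi> v. endomorphism \<psi> \<Longrightarrow> sylvester_prod l N cs \<psi> v = 0"
proof -
  obtain \<theta> :: "nat \<Rightarrow> 'v \<Rightarrow> complex" and d :: "nat \<Rightarrow> complex" where
    \<theta>_add: "\<And>i v w. i < card Basis \<Longrightarrow> \<theta> i (v + w) = \<theta> i v + \<theta> i w"
    and \<theta>_scale: "\<And>i c v. i < card Basis \<Longrightarrow> \<theta> i (scale c v) = to_complex c * \<theta> i v"
    and \<theta>_d: "\<And>i v. i < card Basis \<Longrightarrow> \<theta> i (N v) = d i * \<theta> i v"
    and sep: "\<And>v. (\<And>i. i < card Basis \<Longrightarrow> \<theta> i v = 0) \<Longrightarrow> v = 0"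
    and ev: "\<And>i. i < card Basis \<Longrightarrow> eigenvalue (complex_matrix N) (d i)"
    using semisimple_eigenfunctionals[OF N] by blast
  have d: "d i \<in> \<real>" "Re (d i) > 0" if "i < card Basis" for i
    using pos ev[OF that] by (auto simp: positive_eigenvalues_def)
  then have "\<exists>x::'k. d i = to_complex x" if "i < card Basis" for i
    using Reals_subset_range_to_complex that by blast
  then obtain a :: "nat \<Rightarrow> 'k" where a: "\<And>i. i < card Basis \<Longrightarrow> d i = to_complex (a i)"
    by metis
  have \<theta>_N: "\<theta> i (N v) = to_complex (a i) * \<theta> i v" if "i < card Basis" for i v
    using \<theta>_d a that by simp
  have \<theta>_diff: "\<theta> i (v - w) = \<theta> i v - \<theta> i w" if "i < card Basis" for i v w
    using \<theta>_add[OF that, of "v - w" w] by simp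

  \<comment> \<open>The properties obtained so far do not exclude functionals that vanish
    identically; \<open>reflect\<close> needs nonzero ones.\<close>
  define I where "I = {i. i < card Basis \<and> (\<exists>v. \<theta> i v \<noteq> 0)}"
  have sep_I: "v = 0" if "\<And>i. i \<in> I \<Longrightarrow> \<theta> i v = 0" for v
    using that by (intro sep) (auto simp: I_def)
  have I: "i < card Basis" if "i \<in> I" for i
    using that by (simp add: I_def)
  have finI: "finite I"
    by (simp add: I_def)
  have reflect: "\<exists>k\<in>I. l - a i = a k" if i: "i \<in> I" for i
  proof -
    \<comment> \<open>A nonzero \<open>\<theta> i\<close> vanishes on the image of
      \<open>N - a i\<close>, so this map has a kernel: an eigenvector over the ground field
      itself.\<close>
    have "\<not> surj (\<lambda>v. N v - scale (a i) v)"
    proof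
      assume surj: "surj (\<lambda>v. N v - scale (a i) v)"
      have "\<theta> i (N v - scale (a i) v) = 0" for v
        by (simp add: \<theta>_diff \<theta>_scale \<theta>_N I[OF i])
      then have "\<theta> i w = 0" for w
        using surjD[OF surj, of w] by auto
      then show False
        using i by (simp add: I_def)
    qed
    then obtain X where "X \<noteq> 0" "N X = scale (a i) X"
      unfolding endomorphism_inj_iff_surj[OF endomorphism_shift[OF N(1)], symmetric]
        endomorphism_inj_iff[OF endomorphism_shift[OF N(1)]] by auto
    from conformal_eigenvalue_reflection[OF g N(1) l this]
    obtain Y where Y: "Y \<noteq> 0" "N Y = scale (l - a i) Y"
      by blast
    then obtain k where k: "k \<in> I" "\<theta> k Y \<noteq> 0"
      using sep_I by blast
    \<comment> \<open>Both sides are the factor by which \<open>N\<close> scales the nonzero value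
      \<open>\<theta> k Y\<close>.\<close>
    then have "to_complex (l - a i) = to_complex (a k)"
      using \<theta>_N[of k Y] \<theta>_scale[of k "l - a i" Y] I by (simp add: Y(2))
    then show ?thesis
      using k(1) by auto
  qed

  obtain cs where cs: "set cs = (\<lambda>(i, j). l - a i + a j) ` (I \<times> I)"
    using finite_list[of "(\<lambda>(i, j). l - a i + a j) ` (I \<times> I)"] finI by auto
  show ?thesis
  proof
    have "l - a i + a j \<noteq> 0" if ij: "i \<in> I" "j \<in> I" for i j
    proof -
      obtain k where k: "k \<in> I" "l - a i = a k"
        using reflect[OF ij(1)] by blast
      \<comment> \<open>The class of ground fields has no order, so positivity is read off from real
        parts of the embedded scalars.\<close>
      have "Re (to_complex (a k + a j)) > 0"
        using d(2)[of k] d(2)[of j] a[of k] a[of j] I ij k(1) by (simp add: to_complex_add)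
      then show ?thesis
        using k(2) by auto
    qed
    then show "0 \<notin> set cs"
      by (auto simp: cs)
  next
    fix \<psi> v assume \<psi>: "endomorphism \<psi>"
    interpret \<psi>: Vector_Spaces.linear scale scale \<psi> by (rule \<psi>)
    show "sylvester_prod l N cs \<psi> v = 0"
    proof (rule sep_I)
      fix i assume i: "i \<in> I"
      \<comment> \<open>The functional \<open>\<theta> i\<close> absorbs the left multiplication;
        the vector left over is killed by every \<open>\<theta> j\<close>.\<close>
      let ?w = "foldr (\<lambda>c v. N v - scale (c - (l - a i)) v) cs v"
      have "?w = 0"
      proof (rule sep_I)
        fix j assume j: "j \<in> I"
        have "l - a i + a j \<in> set cs"
          using i j by (auto simp: cs)
        then have "(\<Prod>c\<leftarrow>cs. to_complex ((l - a i) + a j - c)) = 0"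
          by (force simp: prod_list_zero_iff)
        then show "\<theta> j ?w = 0"
          using eigenfunctional_shift_prod[of "\<theta> j" N "a j" "l - a i" cs v] \<theta>_add \<theta>_scale \<theta>_N I[OF j]
          by simp
      qed
      moreover have "\<theta> i 0 = 0"
        using \<theta>_add[OF I[OF i], of 0 0] by simp
      ultimately show "\<theta> i (sylvester_prod l N cs \<psi> v) = 0"
        using eigenfunctional_sylvester_prod[of "\<theta> i" N "a i" \<psi> l cs v] \<theta>_add \<theta>_scale \<theta>_N I[OF i] \<psi> N(1)
        by (simp add: \<psi>.zero)
    qed
  qed
qed

section \<open>Solitariness of the metric\<close>

theorem solitary_if_positive_conformal_derivation:
  assumes ad: "ad_invariant_metric g" and "N \<in> conformal g" and N: "derivation N"
    and "semisimple N" and "positive_eigenvalues N"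
  shows "solitary g"
  unfolding solitary_def
proof (intro conjI allI impI)
  have g: "is_metric g"
    using ad by (simp add: ad_invariant_metric_def)
  obtain l where l: "\<And>X Y. g (N X) Y + g X (N Y) = l * g X Y"
    using assms(2) by (auto simp: conformal_def)
  fix \<phi> assume \<phi>: "ad_invariant_map \<phi> \<and> adjoint_wrt g \<phi> = \<phi>"
  then have end\<phi>: "endomorphism \<phi>"
    by (simp add: ad_invariant_map_def)
  \<comment> \<open>Uniqueness of the adjoint turns the fixed-point equation into symmetry of
    \<open>\<phi>\<close> with respect to \<open>g\<close>.\<close>
  have \<phi>_in: "\<phi> \<in> self_adjoint_centroid g"
    using \<phi> adjoint_wrt_unique[OF g end\<phi>, of \<phi>] by (simp add: self_adjoint_centroid_def)
  have "endomorphism N"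
    using N by (simp add: derivation_def)
  then obtain cs where "0 \<notin> set cs" "\<And>\<psi> v. endomorphism \<psi> \<Longrightarrow> sylvester_prod l N cs \<psi> v = 0"
    using semisimple_sylvester_prod_eq_0[OF _ assms(4,5) g l] by blast
  then obtain \<psi> where \<psi>: "\<psi> \<in> self_adjoint_centroid g" and eq: "\<And>X. \<phi> X = sylvester l N \<psi> X"
    using sylvester_preimage[OF g N l \<phi>_in, of cs] end\<phi> by blast
  \<comment> \<open>The derivation is \<open>\<psi> \<circ> N\<close>, with \<open>\<psi>\<close>
    the preimage of \<open>\<phi>\<close> under \<open>T\<close>.\<close>
  show "\<exists>D. derivation D \<and> (\<forall>X. \<phi> X = D X + adjoint_wrt g D X)"
    using sylvester_eq_derivation_plus_adjoint[OF g N l \<psi>] eq by metis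
qed (rule ad)

end

theorem theorem4p19:
  fixes scale :: "'k::real_or_complex \<Rightarrow> 'v::ab_group_add \<Rightarrow> 'v"
    and Basis :: "'v set"
    and bracket :: "'v \<Rightarrow> 'v \<Rightarrow> 'v"
    and g :: "'v \<Rightarrow> 'v \<Rightarrow> 'k"
    and N :: "'v \<Rightarrow> 'v"
  assumes "lie_algebra scale Basis bracket"
    and "lie_algebra.ad_invariant_metric scale bracket g"
    and "lie_algebra.metric_nikolayevsky scale Basis bracket g N"
    and "lie_algebra.positive_eigenvalues scale Basis N"
  shows "lie_algebra.solitary scale bracket g"
proof -
  interpret lie_algebra scale Basis bracket
    by (rule assms(1))
  show ?thesis
    using solitary_if_positive_conformal_derivation[of g N] assms(2-4)
    by (auto simp: metric_nikolayevsky_def)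
qed

end
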